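(* Let $G$ be a connected graph with $n$ vertices. Then $B(G)\ge\frac{n-1}{n}$, with equality if and only if $G$ is isomorphic to the complete graph $K_n$.
   Context: All graphs are finite, simple and undirected. The Laplacian matrix of $G$ is $L=D-A$ ($A$ adjacency matrix, $D$ diagonal degree matrix). $L^{+}$ is the Moore–Penrose inverse of $L$ and $L^{2+}=(L^{+})^2$. The biharmonic distance is the nonnegative number $d_B(u,v)$ with $d_B^2(u,v)=L^{2+}_{uu}+L^{2+}_{vv}-2L^{2+}_{uv}$, and the biharmonic index is $B(G)=\frac12\sum_{u\in V(G)}\sum_{v\in V(G)}d_B^2(u,v)$. *)

theory Defs
  imports "HOL-Analysis.Analysis" "Graph_Theory.Digraph_Isomorphism"
begin

text \<open>
  A finite simple undirected graph is a \<^locale>\<open>graph\<close>: a finite symmetric digraph without loops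
  and without parallel arcs, an undirected edge being a pair of opposite arcs. For the matrices
  below to be square matrices indexed by the vertices, the vertices are the elements of a finite
  type; the definitions are meant for graphs \<open>G\<close> with \<open>verts G = UNIV\<close>.
\<close>

definition adjacency_matrix :: "('v::finite, 'e) pre_digraph \<Rightarrow> real^'v^'v" where
  "adjacency_matrix G = (\<chi> u v. if u \<rightarrow>\<^bsub>G\<^esub> v then 1 else 0)"

text \<open>In a symmetric digraph, the out-degree of a vertex is its degree in the undirected graph.\<close>

definition degree_matrix :: "('v::finite, 'e) pre_digraph \<Rightarrow> real^'v^'v" where
  "degree_matrix G = (\<chi> u v. if u = v then real (out_degree G u) else 0)"

definition laplacian :: "('v::finite, 'e) pre_digraph \<Rightarrow> real^'v^'v" where
  "laplacian G = degree_matrix G - adjacency_matrix G"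

text \<open>The four Penrose conditions; every real matrix has exactly one Moore--Penrose inverse.\<close>

definition is_moore_penrose :: "real^'n^'m \<Rightarrow> real^'m^'n \<Rightarrow> bool" where
  "is_moore_penrose A X \<longleftrightarrow>
     A ** X ** A = A \<and> X ** A ** X = X \<and>
     transpose (A ** X) = A ** X \<and> transpose (X ** A) = X ** A"

definition moore_penrose :: "real^'n^'m \<Rightarrow> real^'m^'n" where
  "moore_penrose A = (THE X. is_moore_penrose A X)"

definition laplacian_pinv_sq :: "('v::finite, 'e) pre_digraph \<Rightarrow> real^'v^'v" where
  "laplacian_pinv_sq G = moore_penrose (laplacian G) ** moore_penrose (laplacian G)"

text \<open>
  The radicand is nonnegative, since the square of the symmetric matrix \<open>L\<^sup>+\<close> is positive
  semidefinite.
\<close>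

definition biharmonic_distance :: "('v::finite, 'e) pre_digraph \<Rightarrow> 'v \<Rightarrow> 'v \<Rightarrow> real" where
  "biharmonic_distance G u v =
     sqrt (laplacian_pinv_sq G $ u $ u + laplacian_pinv_sq G $ v $ v
           - 2 * laplacian_pinv_sq G $ u $ v)"

definition biharmonic_index :: "('v::finite, 'e) pre_digraph \<Rightarrow> real" where
  "biharmonic_index G =
     1/2 * (\<Sum>u\<in>verts G. \<Sum>v\<in>verts G. (biharmonic_distance G u v)\<^sup>2)"

definition complete_graph :: "nat \<Rightarrow> nat pair_pre_digraph" where
  "complete_graph n = \<lparr> pverts = {..<n}, parcs = {(i, j). i < n \<and> j < n \<and> i \<noteq> j} \<rparr>"

end

theory Submission
  imports Defs
begin

text \<open>
  Let \<open>P = I - J/n\<close> and \<open>M = L\<^sup>+\<close>. Connectedness gives \<open>L M = M L = P\<close>, and \<open>B(G)\<close> is \<open>n\<close> times the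
  squared Frobenius norm of \<open>M\<close>. With \<open>R(u,v) = M\<^sub>u\<^sub>u + M\<^sub>v\<^sub>v - 2 M\<^sub>u\<^sub>v \<ge> 0\<close>,
  half the sum of \<open>R\<close> over adjacent ordered pairs is \<open>tr (L M) = n - 1\<close>, while half the sum over
  all ordered pairs is \<open>n tr M\<close>; hence \<open>tr M \<ge> (n - 1)/n\<close>. Expanding
  \<open>\<parallel>M - P/n\<parallel>\<^sup>2\<close> then yields
  \<open>B(G) \<ge> (n - 1)/n + n \<parallel>M - P/n\<parallel>\<^sup>2\<close>. Equality forces \<open>M = P/n\<close>, that is
  \<open>L = n P\<close>, which is the Laplacian of the complete graph.
\<close>

section \<open>Uniqueness of the Moore-Penrose inverse\<close>

lemma is_moore_penrose_unique:
  assumes X: "is_moore_penrose A X" and Y: "is_moore_penrose A Y"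
  shows "X = Y"
proof -
  have X': "A ** X ** A = A" "X ** A ** X = X" "transpose (A ** X) = A ** X" "transpose (X ** A) = X ** A"
    and Y': "A ** Y ** A = A" "Y ** A ** Y = Y" "transpose (A ** Y) = A ** Y" "transpose (Y ** A) = Y ** A"
    using X Y by (auto simp: is_moore_penrose_def)
  \<comment> \<open>Here \<open>A ** Y ** A = A\<close> inserts \<open>A ** Y\<close> in front;
    transposition then swaps the two symmetric factors, and \<open>A ** X ** A = A\<close> absorbs
    the other one.\<close>
  have "A ** X = transpose ((A ** Y) ** (A ** X))"
    using X'(3) Y'(1) by (simp add: matrix_mul_assoc)
  also have "\<dots> = (A ** X ** A) ** Y"
    using X'(3) Y'(3) by (metis matrix_transpose_mul matrix_mul_assoc)
  finally have AX: "A ** X = A ** Y" using X'(1) by simp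
  have "X ** A = transpose ((X ** A) ** (Y ** A))"
    using X'(4) Y'(1) by (metis matrix_mul_assoc)
  also have "\<dots> = Y ** (A ** X ** A)"
    using X'(4) Y'(4) by (metis matrix_transpose_mul matrix_mul_assoc)
  finally have XA: "X ** A = Y ** A" using X'(1) by simp
  have "X = X ** (A ** X)" using X'(2) by (simp add: matrix_mul_assoc)
  also have "\<dots> = Y ** A ** Y" by (metis AX XA matrix_mul_assoc)
  finally show ?thesis using Y'(2) by simp
qed

lemma moore_penrose_eqI: "is_moore_penrose A X \<Longrightarrow> moore_penrose A = X"
  unfolding moore_penrose_def by (blast intro: is_moore_penrose_unique)

section \<open>The orthogonal projection \<open>I - J/n\<close> onto vectors of coordinate sum zero,
  and matrix arithmetic\<close>

definition centering :: "real^'n^'n" where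
  "centering = (\<chi> i j. (if i = j then 1 else 0) - 1 / real CARD('n))"

lemma centering_nth: "centering $ i $ j = (if i = j then 1 else 0) - 1 / real CARD('n)"
  for i j :: "'n::finite"
  by (simp add: centering_def)

lemma transpose_centering [simp]: "transpose centering = centering"
  by (simp add: centering_def transpose_def vec_eq_iff)

lemma trace_centering: "trace (centering :: real^'n^'n) = real CARD('n) - 1"
  by (simp add: trace_def centering_nth sum_subtractf right_diff_distrib)

lemma matrix_mul_centering_nth:
  "(A ** centering) $ i $ j = A $ i $ j - (\<Sum>k\<in>UNIV. A $ i $ k) / real CARD('n)"
  for A :: "real^'n^'m"
proof -
  have "(A ** centering) $ i $ j
      = (\<Sum>k\<in>UNIV. (if k = j then A $ i $ k else 0) - A $ i $ k / real CARD('n))"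
    unfolding matrix_matrix_mult_def centering_nth by (simp, intro sum.cong) (auto simp: algebra_simps)
  then show ?thesis by (simp add: sum_subtractf sum_divide_distrib)
qed

text \<open>Right multiplication by \<open>centering\<close> subtracts from every entry the mean of
  its row. Vanishing row sums thus become an algebraic identity, and conversely.\<close>

lemma matrix_mul_centering_iff:
  "A ** centering = A \<longleftrightarrow> (\<forall>i. (\<Sum>k\<in>UNIV. A $ i $ k) = 0)" for A :: "real^'n^'m"
  by (simp add: vec_eq_iff matrix_mul_centering_nth)

lemma centering_idem: "(centering :: real^'n^'n) ** centering = centering"
  by (simp add: matrix_mul_centering_iff centering_nth sum_subtractf)

text \<open>The inner product of the nested vector type is the Frobenius one, so \<open>norm\<close>
  of a matrix is its Frobenius norm.\<close>

lemma inner_matrix_eq_trace: "A \<bullet> B = trace (transpose A ** B)" for A B :: "real^'n^'m"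
  by (simp add: inner_vec_def trace_def matrix_matrix_mult_def transpose_def) (rule sum.swap)

lemma matrix_mul_add_left: "(A + B) ** C = A ** C + B ** C" for A B :: "real^'n^'m"
  by (simp add: vec_eq_iff matrix_matrix_mult_def distrib_right sum.distrib)

lemma matrix_mul_minus_left: "(A - B) ** C = A ** C - B ** C" for A B :: "real^'n^'m"
  by (simp add: vec_eq_iff matrix_matrix_mult_def left_diff_distrib sum_subtractf)

lemma matrix_mul_minus_right: "A ** (B - C) = A ** B - A ** C" for A :: "real^'n^'m"
  by (simp add: vec_eq_iff matrix_matrix_mult_def right_diff_distrib sum_subtractf)

text \<open>The kernel of \<open>A\<close> consists exactly of the constant vectors. Adding the
  projection \<open>Q = J/n\<close> onto them makes \<open>A\<close> invertible, and subtracting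
  \<open>Q\<close> from the inverse gives the pseudoinverse.\<close>

lemma moore_penrose_constant_kernel:
  fixes A :: "real^'n^'n"
  assumes sym: "transpose A = A"
    and AP: "A ** centering = A"
    and ker: "\<And>x i j. A *v x = 0 \<Longrightarrow> x $ i = x $ j"
  defines "M \<equiv> moore_penrose A"
  shows "A ** M = centering" "M ** A = centering" "M ** centering = M" "transpose M = M"
    "centering ** M = M"
proof -
  define P :: "real^'n^'n" where "P = centering"
  define Q where "Q = mat 1 - P"
  have P: "P ** P = P" "transpose P = P" by (simp_all add: P_def centering_idem)
  have PA: "P ** A = A"
    using arg_cong[OF AP, of transpose] sym by (simp add: P_def matrix_transpose_mul)
  have AQ: "A ** Q = 0" and QA: "Q ** A = 0" and QQ: "Q ** Q = Q"
    using AP PA P by (simp_all add: Q_def P_def matrix_mul_minus_left matrix_mul_minus_right)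
  \<comment> \<open>Applying \<open>Q\<close> separates the two summands: both \<open>Q *v x\<close>
    and \<open>A *v x\<close> vanish, so \<open>x\<close> is constant with mean zero.\<close>
  have "x = 0" if x: "(A + Q) *v x = 0" for x
  proof -
    have "Q *v x = (Q ** (A + Q)) *v x"
      using QA QQ by (simp add: matrix_add_ldistrib)
    also have "\<dots> = 0" using x by (simp add: matrix_vector_mul_assoc[symmetric])
    finally have Qx: "Q *v x = 0" .
    with x have "A *v x = 0" by (simp add: matrix_vector_mult_add_rdistrib)
    from ker[OF this] have const: "x $ i = x $ j" for i j .
    show "x = 0"
    proof (subst vec_eq_iff, intro allI)
      fix i
      have "0 = (Q *v x) $ i" using Qx by simp
      also have "\<dots> = (\<Sum>j\<in>UNIV. x $ j / real CARD('n))"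
        by (simp add: matrix_vector_mult_def Q_def P_def mat_def centering_nth)
      also have "\<dots> = (\<Sum>j\<in>(UNIV :: 'n set). x $ i / real CARD('n))"
        by (intro sum.cong arg_cong2[where f = "(/)"] refl const)
      finally show "x $ i = 0 $ i" by simp
    qed
  qed
  then obtain N where NL: "N ** (A + Q) = mat 1"
    using matrix_left_invertible_ker[of "A + Q"] by blast
  then have NR: "(A + Q) ** N = mat 1" by (simp add: matrix_left_right_inverse)
  \<comment> \<open>Since \<open>A + Q\<close> acts as the identity on the range of
    \<open>Q\<close>, so does its inverse \<open>N\<close>.\<close>
  have "N ** Q = N ** ((A + Q) ** Q)" using AQ QQ by (simp add: matrix_mul_add_left)
  then have NQ: "N ** Q = Q" by (metis NL matrix_mul_assoc matrix_mul_lid)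
  have "Q ** N = (Q ** (A + Q)) ** N" using QA QQ by (simp add: matrix_add_ldistrib)
  then have QN: "Q ** N = Q" by (metis NR matrix_mul_assoc matrix_mul_rid)
  define X where "X = N - Q"
  have AX: "A ** X = P"
    using NR QN AQ unfolding X_def Q_def[symmetric]
    by (simp add: matrix_mul_minus_right matrix_mul_add_left)
      (simp add: Q_def eq_diff_eq)
  have XA: "X ** A = P"
    using NL NQ QA unfolding X_def
    by (simp add: matrix_mul_minus_left matrix_add_ldistrib)
      (simp add: Q_def eq_diff_eq)
  have XQ: "X ** Q = 0" "Q ** X = 0"
    using NQ QN QQ by (simp_all add: X_def matrix_mul_minus_left matrix_mul_minus_right)
  have Pq: "P = mat 1 - Q" by (simp add: Q_def)
  have XP: "X ** P = X" "P ** X = X"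
    unfolding Pq using XQ by (simp_all add: matrix_mul_minus_left matrix_mul_minus_right)
  have "is_moore_penrose A X"
    using AX XA XP PA P by (simp add: is_moore_penrose_def)
  then have MX: "M = X" unfolding M_def by (rule moore_penrose_eqI)
  \<comment> \<open>Writing \<open>P\<close> as \<open>A ** X\<close> and using the symmetry of
    \<open>A\<close> regroups the product as \<open>transpose (A ** X) ** X\<close>, which is
    \<open>P ** X\<close>.\<close>
  have "transpose X = transpose (P ** X)" using XP by simp
  also have "\<dots> = transpose X ** (A ** X)" using AX P by (simp add: matrix_transpose_mul)
  also have "\<dots> = transpose (A ** X) ** X" using sym by (simp add: matrix_transpose_mul matrix_mul_assoc)
  finally have "transpose X = X" using AX P XP by simp
  then show "A ** M = centering" "M ** A = centering" "M ** centering = M" "transpose M = M"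
    "centering ** M = M"
    using MX AX XA XP by (simp_all add: P_def)
qed

text \<open>Exchanging the summation variables leaves symmetric weights unchanged, so
  \<open>f u v\<close> may be averaged with \<open>f v u\<close>.\<close>

lemma symmetric_sum_halve:
  fixes f :: "'a \<Rightarrow> 'a \<Rightarrow> real"
  assumes "\<And>u v. a u v = a v u"
  shows "(\<Sum>u\<in>S. \<Sum>v\<in>S. a u v * f u v) = (\<Sum>u\<in>S. \<Sum>v\<in>S. a u v * (f u v + f v u)) / 2"
proof -
  have "(\<Sum>u\<in>S. \<Sum>v\<in>S. a u v * f v u) = (\<Sum>u\<in>S. \<Sum>v\<in>S. a u v * f u v)"
    by (subst sum.swap) (simp add: assms)
  then show ?thesis by (simp add: algebra_simps sum.distrib)
qed

section \<open>Adjacency, degrees and the Laplacian\<close>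

lemma adjacency_matrix_nth: "adjacency_matrix G $ u $ v = (if u \<rightarrow>\<^bsub>G\<^esub> v then 1 else 0)"
  by (simp add: adjacency_matrix_def)

lemma (in graph) adjacent_sym: "u \<rightarrow>\<^bsub>G\<^esub> v \<longleftrightarrow> v \<rightarrow>\<^bsub>G\<^esub> u"
  using graph_symmetric by blast

text \<open>Without parallel arcs, an arc leaving \<open>u\<close> is determined by its
  head.\<close>

lemma (in digraph) out_degree_eq_card_adjacent: "out_degree G u = card {v. u \<rightarrow>\<^bsub>G\<^esub> v}"
proof -
  have "inj_on (head G) (out_arcs G u)"
    by (rule inj_onI) (auto intro: no_multi_arcs simp: arc_to_ends_def)
  moreover have "head G ` out_arcs G u = {v. u \<rightarrow>\<^bsub>G\<^esub> v}"
    by (auto simp: arcs_ends_conv)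
  ultimately show ?thesis unfolding out_degree_def by (metis card_image)
qed

context
  fixes G :: "('v::finite, 'e) pre_digraph"
  assumes graph: "graph G" and verts: "verts G = UNIV"
begin

interpretation graph G by (fact graph)

lemma adjacency_matrix_sym: "adjacency_matrix G $ u $ v = adjacency_matrix G $ v $ u"
  by (simp add: adjacency_matrix_nth adjacent_sym[of u v])

lemma out_degree_eq_sum_adjacency: "real (out_degree G u) = (\<Sum>v\<in>UNIV. adjacency_matrix G $ u $ v)"
  by (simp add: out_degree_eq_card_adjacent adjacency_matrix_nth sum.If_cases)

lemma laplacian_nth:
  "laplacian G $ u $ v = (if u = v then real (out_degree G u) else 0) - adjacency_matrix G $ u $ v"
  by (simp add: laplacian_def degree_matrix_def)

lemma transpose_laplacian: "transpose (laplacian G) = laplacian G"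
  by (auto simp: vec_eq_iff transpose_def laplacian_nth adjacency_matrix_sym)

text \<open>The degree is a row sum of the adjacency matrix, so the diagonal term distributes over
  the neighbours. Arbitrary \<open>f\<close> covers constants, vectors and columns of the
  pseudoinverse alike.\<close>

lemma sum_laplacian_mult:
  "(\<Sum>v\<in>UNIV. laplacian G $ u $ v * f v) = (\<Sum>v\<in>UNIV. adjacency_matrix G $ u $ v * (f u - f v))"
proof -
  have "(\<Sum>v\<in>UNIV. laplacian G $ u $ v * f v)
      = (\<Sum>v\<in>UNIV. (if u = v then real (out_degree G u) * f v else 0) - adjacency_matrix G $ u $ v * f v)"
    unfolding laplacian_nth by (intro sum.cong) (auto simp: algebra_simps)
  then show ?thesis
    by (simp add: sum_subtractf out_degree_eq_sum_adjacency sum_distrib_right right_diff_distrib)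
qed

lemma laplacian_mul_centering: "laplacian G ** centering = laplacian G"
  using sum_laplacian_mult[of _ "\<lambda>_. 1"] by (simp add: matrix_mul_centering_iff)

text \<open>This is the Dirichlet energy; the half compensates for counting each edge in both
  directions.\<close>

lemma laplacian_quadratic_form:
  "x \<bullet> (laplacian G *v x)
    = (\<Sum>u\<in>UNIV. \<Sum>v\<in>UNIV. adjacency_matrix G $ u $ v * (x $ u - x $ v)\<^sup>2) / 2"
proof -
  have "x \<bullet> (laplacian G *v x)
      = (\<Sum>u\<in>UNIV. \<Sum>v\<in>UNIV. adjacency_matrix G $ u $ v * (x $ u * (x $ u - x $ v)))"
    by (simp only: inner_vec_def inner_real_def matrix_vector_mult_def vec_lambda_beta sum_laplacian_mult)
      (simp only: sum_distrib_left mult.left_commute)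
  also have "\<dots> = (\<Sum>u\<in>UNIV. \<Sum>v\<in>UNIV. adjacency_matrix G $ u $ v *
      (x $ u * (x $ u - x $ v) + x $ v * (x $ v - x $ u))) / 2"
    by (rule symmetric_sum_halve) (rule adjacency_matrix_sym)
  also have "\<dots> = (\<Sum>u\<in>UNIV. \<Sum>v\<in>UNIV. adjacency_matrix G $ u $ v * (x $ u - x $ v)\<^sup>2) / 2"
    by (simp add: power2_eq_square algebra_simps)
  finally show ?thesis .
qed

lemma laplacian_positive_semidefinite: "0 \<le> x \<bullet> (laplacian G *v x)"
  unfolding laplacian_quadratic_form by (simp add: sum_nonneg adjacency_matrix_nth)

text \<open>Zero energy makes every summand vanish, so \<open>x\<close> agrees across each arc and
  hence along walks.\<close>

lemma laplacian_kernel_constant: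
  assumes conn: "Digraph_Component.connected G" and x: "laplacian G *v x = 0"
  shows "x $ u = x $ v"
proof -
  have "(\<Sum>u\<in>UNIV. \<Sum>v\<in>UNIV. adjacency_matrix G $ u $ v * (x $ u - x $ v)\<^sup>2) = 0"
    using laplacian_quadratic_form[of x] x by simp
  then have zero: "adjacency_matrix G $ u $ v * (x $ u - x $ v)\<^sup>2 = 0" for u v
    by (simp add: sum_nonneg_eq_0_iff sum_nonneg adjacency_matrix_nth)
  have step: "x $ u = x $ v" if "u \<rightarrow>\<^bsub>G\<^esub> v" for u v
    using zero[of u v] that by (simp add: adjacency_matrix_nth)
  have "u \<rightarrow>\<^sup>*\<^bsub>mk_symmetric G\<^esub> v"
    \<comment> \<open>Connectedness refers to the symmetric closure, which has the same reachability
      because the arcs of \<open>G\<close> are already symmetric.\<close>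
    using conn verts by (auto simp: connected_def)
  then have "u \<rightarrow>\<^sup>*\<^bsub>G\<^esub> v"
    using reachable_mk_symmetric_eq[OF sym_arcs] by blast
  then show ?thesis by induct (auto dest: step)
qed

text \<open>The scaled projection has off-diagonal entries -1, which the Laplacian attains exactly
  at adjacent pairs; its diagonal entries n - 1 are then the degrees.\<close>

lemma laplacian_eq_scaled_centering_iff:
  "laplacian G = real CARD('v) *\<^sub>R centering \<longleftrightarrow> (\<forall>u v. u \<noteq> v \<longrightarrow> u \<rightarrow>\<^bsub>G\<^esub> v)"
proof
  assume L: "laplacian G = real CARD('v) *\<^sub>R centering"
  show "\<forall>u v. u \<noteq> v \<longrightarrow> u \<rightarrow>\<^bsub>G\<^esub> v"
  proof (intro allI impI)
    fix u v :: 'v assume "u \<noteq> v"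
    moreover have "laplacian G $ u $ v = (real CARD('v) *\<^sub>R centering) $ u $ v" by (simp add: L)
    ultimately show "u \<rightarrow>\<^bsub>G\<^esub> v"
      by (simp add: laplacian_nth centering_nth adjacency_matrix_nth split: if_splits)
  qed
next
  assume adj: "\<forall>u v. u \<noteq> v \<longrightarrow> u \<rightarrow>\<^bsub>G\<^esub> v"
  then have "{v. u \<rightarrow>\<^bsub>G\<^esub> v} = UNIV - {u}" for u
    using adj_not_same by auto
  then have "real (out_degree G u) = real CARD('v) - 1" for u
    by (simp add: out_degree_eq_card_adjacent card_Diff_singleton of_nat_diff Suc_leI)
  then show "laplacian G = real CARD('v) *\<^sub>R centering"
    using adj adj_not_same
    by (auto simp: vec_eq_iff laplacian_nth centering_nth adjacency_matrix_nth right_diff_distrib)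
qed

section \<open>The pseudoinverse of the Laplacian of a connected graph\<close>

context
  assumes conn: "Digraph_Component.connected G"
begin

lemmas laplacian_pinv = moore_penrose_constant_kernel[OF transpose_laplacian
    laplacian_mul_centering laplacian_kernel_constant[OF conn]]

lemma laplacian_pinv_sym:
  "moore_penrose (laplacian G) $ u $ v = moore_penrose (laplacian G) $ v $ u"
  using arg_cong[OF laplacian_pinv(4), of "\<lambda>A. A $ u $ v"] by (simp add: transpose_def)

lemma sum_laplacian_pinv: "(\<Sum>v\<in>UNIV. moore_penrose (laplacian G) $ u $ v) = 0"
  using laplacian_pinv(3) by (simp add: matrix_mul_centering_iff)

text \<open>This effective resistance is the quadratic form of \<open>M\<close> at
  \<open>axis u 1 - axis v 1\<close>. As \<open>M = M ** L ** M\<close> with \<open>M\<close>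
  symmetric, it equals the energy of \<open>M *v x\<close>.\<close>

lemma resistance_nonneg:
  "0 \<le> moore_penrose (laplacian G) $ u $ u + moore_penrose (laplacian G) $ v $ v
      - 2 * moore_penrose (laplacian G) $ u $ v"
proof -
  define M where "M = moore_penrose (laplacian G)"
  define x :: "real^'v" where "x = axis u 1 - axis v 1"
  have "M ** laplacian G ** M = M"
    using laplacian_pinv(2,5) by (simp add: M_def)
  then have "x \<bullet> (M *v x) = x \<bullet> (M *v (laplacian G *v (M *v x)))"
    by (simp add: matrix_vector_mul_assoc matrix_mul_assoc)
  also have "\<dots> = (M *v x) \<bullet> (laplacian G *v (M *v x))"
    using laplacian_pinv(4) by (metis M_def dot_lmul_matrix transpose_matrix_vector)
  also have "\<dots> \<ge> 0" by (rule laplacian_positive_semidefinite)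
  finally have "0 \<le> x \<bullet> (M *v x)" .
  also have "x \<bullet> (M *v x) = M $ u $ u + M $ v $ v - 2 * M $ u $ v"
    using laplacian_pinv_sym[of u v]
    by (simp add: x_def inner_diff_left inner_axis' matrix_vector_mult_diff_distrib
        matrix_vector_mult_basis column_def M_def)
  finally show ?thesis by (simp add: M_def)
qed

lemma trace_laplacian_pinv_ge:
  "real CARD('v) - 1 \<le> real CARD('v) * trace (moore_penrose (laplacian G))"
proof -
  define M where "M = moore_penrose (laplacian G)"
  define R where "R u v = M $ u $ u + M $ v $ v - 2 * M $ u $ v" for u v
  have "real CARD('v) - 1 = trace (laplacian G ** M)"
    using laplacian_pinv(1) by (simp add: M_def trace_centering)
  also have "\<dots> = (\<Sum>u\<in>UNIV. \<Sum>v\<in>UNIV. adjacency_matrix G $ u $ v * (M $ u $ u - M $ v $ u))"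
    by (simp add: trace_def matrix_matrix_mult_def sum_laplacian_mult)
  also have "\<dots> = (\<Sum>u\<in>UNIV. \<Sum>v\<in>UNIV. adjacency_matrix G $ u $ v *
      ((M $ u $ u - M $ v $ u) + (M $ v $ v - M $ u $ v))) / 2"
    by (rule symmetric_sum_halve) (rule adjacency_matrix_sym)
  also have "\<dots> = (\<Sum>u\<in>UNIV. \<Sum>v\<in>UNIV. adjacency_matrix G $ u $ v * R u v) / 2"
    using laplacian_pinv_sym by (simp add: R_def M_def algebra_simps)
  \<comment> \<open>Up to here this is Foster's theorem; nonnegative resistances of nonadjacent
    pairs are now added.\<close>
  also have "\<dots> \<le> (\<Sum>u\<in>UNIV. \<Sum>v\<in>UNIV. R u v) / 2"
    using resistance_nonneg by (intro divide_right_mono sum_mono) (auto simp: adjacency_matrix_nth R_def M_def)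
  \<comment> \<open>The mixed terms vanish with the row sums of \<open>M\<close>; each of the two
    diagonal terms contributes \<open>n * trace M\<close>.\<close>
  also have "\<dots> = real CARD('v) * trace M"
    using sum_laplacian_pinv
    by (simp add: R_def M_def trace_def sum.distrib sum_subtractf sum_distrib_left[symmetric])
  finally show ?thesis by (simp add: M_def)
qed

section \<open>The biharmonic distance and index\<close>

lemma biharmonic_distance_sq:
  "(biharmonic_distance G u v)\<^sup>2
    = (\<Sum>w\<in>UNIV. (moore_penrose (laplacian G) $ u $ w - moore_penrose (laplacian G) $ v $ w)\<^sup>2)"
proof -
  define M where "M = moore_penrose (laplacian G)"
  \<comment> \<open>By symmetry of \<open>M\<close>, the entries of its square are inner products of
    rows, so the radicand is a squared distance between two rows.\<close>
  have sq: "laplacian_pinv_sq G $ a $ b = (\<Sum>w\<in>UNIV. M $ a $ w * M $ b $ w)" for a b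
    using laplacian_pinv_sym by (simp add: laplacian_pinv_sq_def M_def matrix_matrix_mult_def)
  have "laplacian_pinv_sq G $ u $ u + laplacian_pinv_sq G $ v $ v - 2 * laplacian_pinv_sq G $ u $ v
      = (\<Sum>w\<in>UNIV. (M $ u $ w - M $ v $ w)\<^sup>2)"
    by (simp add: sq power2_eq_square sum_distrib_left sum.distrib[symmetric] sum_subtractf[symmetric]
        algebra_simps)
  then show ?thesis by (simp add: biharmonic_distance_def M_def sum_nonneg)
qed

text \<open>In the expanded squared distances the cross terms cancel, as the columns of
  \<open>M\<close> sum to zero; every squared row norm occurs 2n times, and the half leaves
  n.\<close>

lemma biharmonic_index_eq_norm:
  "biharmonic_index G = real CARD('v) * (norm (moore_penrose (laplacian G)))\<^sup>2"
proof -
  define M where "M = moore_penrose (laplacian G)"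
  define r where "r u = (\<Sum>w\<in>UNIV. M $ u $ w * M $ u $ w)" for u
  have "(biharmonic_distance G u v)\<^sup>2 = r u + r v - 2 * (\<Sum>w\<in>UNIV. M $ u $ w * M $ v $ w)" for u v
    unfolding biharmonic_distance_sq M_def[symmetric] r_def
    by (simp add: power2_eq_square sum_distrib_left
        sum.distrib[symmetric] sum_subtractf[symmetric] algebra_simps)
  moreover have "(\<Sum>v\<in>UNIV. \<Sum>w\<in>UNIV. M $ u $ w * M $ v $ w) = 0" for u
  proof -
    have "(\<Sum>v\<in>UNIV. M $ v $ w) = 0" for w
      using sum_laplacian_pinv[of w] laplacian_pinv_sym by (simp add: M_def)
    then show ?thesis by (subst sum.swap) (simp add: sum_distrib_left[symmetric])
  qed
  moreover have "(norm M)\<^sup>2 = (\<Sum>u\<in>UNIV. r u)"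
    by (simp add: power2_norm_eq_inner inner_vec_def r_def)
  ultimately show ?thesis
    by (simp add: biharmonic_index_def verts M_def sum.distrib sum_subtractf sum_distrib_left[symmetric])
qed

lemma norm_centering_sq: "(norm (centering :: real^'v^'v))\<^sup>2 = real CARD('v) - 1"
  by (simp add: power2_norm_eq_inner inner_matrix_eq_trace centering_idem trace_centering)

lemma biharmonic_index_ge:
  "(real CARD('v) - 1) / real CARD('v)
    + real CARD('v) * (norm (moore_penrose (laplacian G) - (1 / real CARD('v)) *\<^sub>R centering))\<^sup>2
    \<le> biharmonic_index G"
proof -
  define n where "n = real CARD('v)"
  define M where "M = moore_penrose (laplacian G)"
  have n: "n > 0" by (simp add: n_def)
  have "M \<bullet> centering = trace M"
    using laplacian_pinv(3,4) by (simp add: inner_matrix_eq_trace M_def)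
  then have "(norm (M - (1 / n) *\<^sub>R centering))\<^sup>2 = (norm M)\<^sup>2 - 2 / n * trace M + (n - 1) / n\<^sup>2"
    using norm_centering_sq n unfolding n_def[symmetric] power2_norm_eq_inner
    by (simp add: inner_diff_left inner_diff_right inner_commute power2_eq_square)
  then have "n * (norm (M - (1 / n) *\<^sub>R centering))\<^sup>2
      = n * ((norm M)\<^sup>2 - 2 / n * trace M + (n - 1) / n\<^sup>2)" by simp
  also have "\<dots> = n * (norm M)\<^sup>2 - 2 * trace M + (n - 1) / n"
    using n by (simp add: field_simps power2_eq_square)
  also have "n * (norm M)\<^sup>2 = biharmonic_index G"
    by (simp add: biharmonic_index_eq_norm n_def M_def)
  finally have "n * (norm (M - (1 / n) *\<^sub>R centering))\<^sup>2 = biharmonic_index G - 2 * trace M + (n - 1) / n" .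
  \<comment> \<open>The trace enters with coefficient 2, so this bound outweighs the summand (n -
    1)/n and leaves one more copy of it.\<close>
  moreover have "(n - 1) / n \<le> trace M"
    using trace_laplacian_pinv_ge n by (simp add: n_def M_def divide_le_eq mult.commute)
  ultimately show ?thesis unfolding n_def M_def by linarith
qed

lemma biharmonic_index_eq_iff:
  "biharmonic_index G = (real CARD('v) - 1) / real CARD('v) \<longleftrightarrow> (\<forall>u v. u \<noteq> v \<longrightarrow> u \<rightarrow>\<^bsub>G\<^esub> v)"
proof -
  define n where "n = real CARD('v)"
  define M where "M = moore_penrose (laplacian G)"
  have n: "n > 0" by (simp add: n_def)
  have "biharmonic_index G = (n - 1) / n \<longleftrightarrow> M = (1 / n) *\<^sub>R centering"
  proof
    assume "biharmonic_index G = (n - 1) / n"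
    then have "n * (norm (M - (1 / n) *\<^sub>R centering))\<^sup>2 \<le> 0"
      using biharmonic_index_ge by (simp add: n_def M_def)
    then show "M = (1 / n) *\<^sub>R centering"
      using n by (simp add: mult_le_0_iff)
  next
    assume "M = (1 / n) *\<^sub>R centering"
    then have "biharmonic_index G = n * (norm ((1 / n) *\<^sub>R (centering :: real^'v^'v)))\<^sup>2"
      using biharmonic_index_eq_norm by (simp add: n_def M_def)
    then show "biharmonic_index G = (n - 1) / n"
      using n norm_centering_sq by (simp add: n_def power_divide power2_eq_square)
  qed
  \<comment> \<open>Multiplying either equation by the other matrix of the pair turns one side into
    the projection, since \<open>L ** M\<close> and \<open>M ** L\<close> both equal
    \<open>centering\<close>.\<close>
  also have "\<dots> \<longleftrightarrow> laplacian G = n *\<^sub>R centering"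
  proof
    assume "M = (1 / n) *\<^sub>R centering"
    then have "centering = (1 / n) *\<^sub>R laplacian G"
      using laplacian_pinv(1) laplacian_mul_centering by (simp add: M_def matrix_scalar_ac scalar_matrix_assoc[symmetric])
    from arg_cong[OF this, of "\<lambda>A. n *\<^sub>R A"] show "laplacian G = n *\<^sub>R centering"
      using n by simp
  next
    assume "laplacian G = n *\<^sub>R centering"
    then have "n *\<^sub>R M = centering"
      using laplacian_pinv(2,3) by (simp add: M_def matrix_scalar_ac scalar_matrix_assoc[symmetric])
    then have "(1 / n) *\<^sub>R centering = (1 / n) *\<^sub>R (n *\<^sub>R M)" by simp
    then show "M = (1 / n) *\<^sub>R centering" using n by simp
  qed
  finally show ?thesis using laplacian_eq_scaled_centering_iff by (simp add: n_def)
qed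

end

end

section \<open>Isomorphism with the complete graph\<close>

lemma (in digraph) digraph_iso_complete_graph_iff:
  "digraph_iso G (with_proj (complete_graph (card (verts G))))
    \<longleftrightarrow> (\<forall>u\<in>verts G. \<forall>v\<in>verts G. u \<noteq> v \<longrightarrow> u \<rightarrow>\<^bsub>G\<^esub> v)"
proof
  assume "digraph_iso G (with_proj (complete_graph (card (verts G))))"
  then obtain h where h: "digraph_isomorphism h"
    and eq: "with_proj (complete_graph (card (verts G))) = app_iso h G"
    unfolding digraph_iso_def by blast
  have V: "iso_verts h ` verts G = {..<card (verts G)}"
    using arg_cong[OF eq, of verts] by (simp add: complete_graph_def)
  have E: "iso_arcs h ` arcs G = {(i, j). i < card (verts G) \<and> j < card (verts G) \<and> i \<noteq> j}"
    using arg_cong[OF eq, of arcs] by (simp add: complete_graph_def)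
  \<comment> \<open>An isomorphism record also prescribes the tail and head maps of its image; here
    they must be the pair projections.\<close>
  have T: "iso_tail h = fst" "iso_head h = snd"
    using arg_cong[OF eq, of tail] arg_cong[OF eq, of head] by simp_all
  show "\<forall>u\<in>verts G. \<forall>v\<in>verts G. u \<noteq> v \<longrightarrow> u \<rightarrow>\<^bsub>G\<^esub> v"
  proof (intro ballI impI)
    fix u v assume uv: "u \<in> verts G" "v \<in> verts G" "u \<noteq> v"
    then have "(iso_verts h u, iso_verts h v) \<in> iso_arcs h ` arcs G"
      using V h by (auto simp: E)
    then obtain e where e: "e \<in> arcs G" "iso_arcs h e = (iso_verts h u, iso_verts h v)" by force
    then have "iso_verts h (tail G e) = iso_verts h u" "iso_verts h (head G e) = iso_verts h v"
      using iso_verts_tail[OF h e(1)] iso_verts_head[OF h e(1)] T by simp_all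
    then have "tail G e = u" "head G e = v" using uv e h by simp_all
    then show "u \<rightarrow>\<^bsub>G\<^esub> v" using e by (auto simp: arcs_ends_conv)
  qed
next
  assume adj: "\<forall>u\<in>verts G. \<forall>v\<in>verts G. u \<noteq> v \<longrightarrow> u \<rightarrow>\<^bsub>G\<^esub> v"
  obtain f where f: "bij_betw f (verts G) {..<card (verts G)}"
    using ex_bij_betw_finite_nat[OF finite_verts] by (auto simp: atLeast0LessThan)
  then have inj: "inj_on f (verts G)" and im: "f ` verts G = {..<card (verts G)}"
    by (auto simp: bij_betw_def)
  \<comment> \<open>Any numbering \<open>f\<close> of the vertices works. Arcs of the target are
    pairs of endpoints, which dictates the arc map.\<close>
  define h where "h = \<lparr> iso_verts = f, iso_arcs = (\<lambda>e. (f (tail G e), f (head G e))),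
      iso_head = snd, iso_tail = fst \<rparr>"
  have "inj_on (\<lambda>e. (f (tail G e), f (head G e))) (arcs G)"
    by (rule inj_onI) (auto intro!: no_multi_arcs simp: arc_to_ends_def inj_on_eq_iff[OF inj])
  then have iso: "digraph_isomorphism h"
    using inj wf_digraph by (simp add: digraph_isomorphism_def h_def)
  have "(\<lambda>e. (f (tail G e), f (head G e))) ` arcs G
      = {(i, j). i < card (verts G) \<and> j < card (verts G) \<and> i \<noteq> j}" (is "?A = ?B")
  proof
    show "?A \<subseteq> ?B"
      using im no_loops by (auto simp: inj_on_eq_iff[OF inj])
    show "?B \<subseteq> ?A"
    proof clarify
      fix i j assume "i < card (verts G)" "j < card (verts G)" "i \<noteq> j"
      then obtain u v where uv: "u \<in> verts G" "v \<in> verts G" "i = f u" "j = f v"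
        using im by (metis imageE lessThan_iff)
      with \<open>i \<noteq> j\<close> have "u \<noteq> v" by auto
      with adj uv have "u \<rightarrow>\<^bsub>G\<^esub> v" by simp
      then show "(i, j) \<in> ?A" using uv by (auto simp: arcs_ends_conv)
    qed
  qed
  then have "with_proj (complete_graph (card (verts G))) = app_iso h G"
    using im by (simp add: app_iso_def h_def with_proj_def complete_graph_def)
  with iso show "digraph_iso G (with_proj (complete_graph (card (verts G))))"
    unfolding digraph_iso_def by blast
qed

theorem theorem4p6:
  fixes G :: "('v::finite, 'e) pre_digraph" and n :: nat
  assumes "graph G"
    and "verts G = UNIV"
    and "Digraph_Component.connected G"
    and "card (verts G) = n"
  shows "biharmonic_index G \<ge> (real n - 1) / real n \<and>
    (biharmonic_index G = (real n - 1) / real n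
       \<longleftrightarrow> digraph_iso G (with_proj (complete_graph n)))"
proof -
  interpret graph G by fact
  have n: "n = CARD('v)" using assms by simp
  have "(real n - 1) / real n \<le> biharmonic_index G"
    using biharmonic_index_ge[OF assms(1-3)] unfolding n
    by (smt (verit) mult_nonneg_nonneg of_nat_0_le_iff zero_le_power2)
  moreover have "biharmonic_index G = (real n - 1) / real n
      \<longleftrightarrow> digraph_iso G (with_proj (complete_graph n))"
    using biharmonic_index_eq_iff[OF assms(1-3)] digraph_iso_complete_graph_iff assms(2)
    by (simp add: n)
  ultimately show ?thesis by blast
qed

end
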